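(* Let $F$ be a real vector space, let $\lambda_1,\ldots,\lambda_m \in F^*$ be linear functionals, and let $\Lambda: F \to \mathbb{R}^m$, $\Lambda(f) = (\lambda_1(f),\ldots,\lambda_m(f))$. Let $\mathcal{K} \subseteq F$ be a convex set containing the origin, let $I$ be a finite index set, and let $\gamma: F \to \mathbb{R}$ be a sup-linear functional, $\gamma(f) = \sup_{i \in I} \gamma_i(f)$, $f \in F$, where the $\gamma_i \in F^*$ are linear functionals. Consider the convex optimization program $$\underset{\substack{e \in \mathbb{R},\ e',e'' \in \mathbb{R}^I\\ c^{(i_\star)} \in \mathbb{R}^m,\ \sigma^{(i_\star)} \in \mathcal{S}^I\ (i_\star \in I)}}{\rm minimize} \quad e \qquad \mbox{subject to } \begin{cases} e'_{i_\star} + e''_{i_\star} \le 2e, & i_\star \in I,\\ \big\| \gamma_{i_\star} - \sum_{k=1}^m c^{(i_\star)}_k \lambda_k \big\|_{\mathcal{K}} \le e'_{i_\star}, & i_\star \in I,\\ \big\| - \sum_{i \in I} \sigma^{(i_\star)}_i \gamma_i + \sum_{k=1}^m c^{(i_\star)}_k \lambda_k \big\|_{\mathcal{K}} \le e''_{i_\star}, & i_\star \in I. \end{cases}$$ Let $\widehat{e}, \widehat{e}', \widehat{e}'', \widehat{c}^{(i_\star)}, \widehat{\sigma}^{(i_\star)}$ ($i_\star \in I$) denote a solution (minimizer) of this program, and set $\widehat{c}^{(i_\star)}_0 := \widehat{e} - \widehat{e}''_{i_\star}$ for all $i_\star \in I$. Then the sup-affine functional $\delta^{\rm opti}: \mathbb{R}^m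 \to \mathbb{R}$ defined by $$\delta^{\rm opti}(y) = \sup_{i \in I} \bigg( \widehat{c}^{(i)}_0 + \sum_{k=1}^m \widehat{c}^{(i)}_k y_k \bigg), \qquad y \in \mathbb{R}^m,$$ is an optimal functional for the estimation of $\gamma$.
   Context: $F^*$ denotes the space of linear functionals on $F$. For $\eta \in F^*$, the notation $\|\eta\|_{\mathcal{K}} := \sup_{f \in \mathcal{K}} \eta(f)$ stands for the support function of $\mathcal{K}$ evaluated at $\eta$ (it may take the value $+\infty$ and is not necessarily a norm). The standard simplex associated with the finite index set $I$ is $\mathcal{S}^I := \{ \sigma \in \mathbb{R}^I : \sigma_i \ge 0 \mbox{ for all } i \in I \mbox{ and } \sum_{i \in I} \sigma_i = 1\}$. The worst-case error over $\mathcal{K}$ of an estimation functional $\delta: \mathbb{R}^m \to \mathbb{R}$ for $\gamma$ is $e(\delta) := \sup_{f \in \mathcal{K}} |\gamma(f) - \delta(\Lambda(f))| \in [0,+\infty]$. For every $\delta: \mathbb{R}^m \to \mathbb{R}$ one has the lower bound $e(\delta) \ge e_\flat$, where $$e_\flat := \sup_{\substack{f',f'' \in \mathcal{K}\\ \Lambda(f')=\Lambda(f'')}} \frac{|\gamma(f')-\gamma(f'')|}{2} \in [0,+\infty].$$ An estimation functional $\delta$ is called (genuinely) optimal if $e(\delta) \le e_\flat$, so that $e(\delta) = e_\flat$ is the minimal value of the error over all functionals from $\mathbb{R}^m$ to $\mathbb{R}$. *)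

theory Defs
  imports "HOL-Analysis.Analysis"
begin

definition obs_map :: "('m::finite \<Rightarrow> 'a \<Rightarrow> real) \<Rightarrow> 'a \<Rightarrow> real ^ 'm" where
  "obs_map lam f = (\<chi> k. lam k f)"

text \<open>Suprema that may be infinite are taken in \<^typ>\<open>ereal\<close>.\<close>

definition support_fun :: "'a set \<Rightarrow> ('a \<Rightarrow> real) \<Rightarrow> ereal" where
  "support_fun K \<eta> = (SUP f\<in>K. ereal (\<eta> f))"

definition std_simplex :: "(real ^ 'i::finite) set" where
  "std_simplex = {\<sigma>. (\<forall>i. 0 \<le> \<sigma> $ i) \<and> (\<Sum>i\<in>UNIV. \<sigma> $ i) = 1}"

definition worst_case_error ::
  "'a set \<Rightarrow> ('m::finite \<Rightarrow> 'a \<Rightarrow> real) \<Rightarrow> ('a \<Rightarrow> real) \<Rightarrow> (real ^ 'm \<Rightarrow> real) \<Rightarrow> ereal" where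
  "worst_case_error K lam \<gamma> \<delta> = (SUP f\<in>K. ereal \<bar>\<gamma> f - \<delta> (obs_map lam f)\<bar>)"

definition error_lower_bound ::
  "'a set \<Rightarrow> ('m::finite \<Rightarrow> 'a \<Rightarrow> real) \<Rightarrow> ('a \<Rightarrow> real) \<Rightarrow> ereal" where
  "error_lower_bound K lam \<gamma> =
     (SUP (f', f'') \<in> {(f', f''). f' \<in> K \<and> f'' \<in> K \<and> obs_map lam f' = obs_map lam f''}.
        ereal (\<bar>\<gamma> f' - \<gamma> f''\<bar> / 2))"

definition optimal_functional ::
  "'a set \<Rightarrow> ('m::finite \<Rightarrow> 'a \<Rightarrow> real) \<Rightarrow> ('a \<Rightarrow> real) \<Rightarrow> (real ^ 'm \<Rightarrow> real) \<Rightarrow> bool" where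
  "optimal_functional K lam \<gamma> \<delta> \<longleftrightarrow>
     worst_case_error K lam \<gamma> \<delta> \<le> error_lower_bound K lam \<gamma>"

text \<open>In the matrices \<open>c\<close> and \<open>\<sigma>\<close>, row \<open>j\<close> is the vector with superscript \<open>j\<close>:
  \<open>c $ j $ k\<close> is the coefficient of \<open>lam k\<close>, and \<open>\<sigma> $ j\<close> is a point of the simplex.\<close>

definition program_feasible ::
  "'a set \<Rightarrow> ('m::finite \<Rightarrow> 'a \<Rightarrow> real) \<Rightarrow> ('i::finite \<Rightarrow> 'a \<Rightarrow> real) \<Rightarrow>
   real \<times> (real ^ 'i) \<times> (real ^ 'i) \<times> (real ^ 'm ^ 'i) \<times> (real ^ 'i ^ 'i) \<Rightarrow> bool" where
  "program_feasible K lam gam = (\<lambda>(e, e', e'', c, \<sigma>).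
     \<forall>j. \<sigma> $ j \<in> std_simplex
       \<and> e' $ j + e'' $ j \<le> 2 * e
       \<and> support_fun K (\<lambda>f. gam j f - (\<Sum>k\<in>UNIV. c $ j $ k * lam k f)) \<le> ereal (e' $ j)
       \<and> support_fun K (\<lambda>f. - (\<Sum>i\<in>UNIV. \<sigma> $ j $ i * gam i f)
                               + (\<Sum>k\<in>UNIV. c $ j $ k * lam k f)) \<le> ereal (e'' $ j))"

end

theory Submission
  imports Defs
begin

text \<open>Write \<open>r\<close> for the lower bound, the supremum of \<open>\<bar>\<gamma> f - \<gamma> h\<bar> / 2\<close> over pairs
  \<open>f, h\<close> in \<open>K\<close> with the same observations.  Two facts give optimality.

  The value \<open>e\<close> of any feasible point bounds the worst-case error of the estimator built from
  it (\<open>worst_case_error_le_of_feasible\<close>).  Where \<open>\<gamma> f\<close> equals \<open>gam j f\<close>, the \<open>j\<close>-th affine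
  piece of \<open>\<delta>\<close> underestimates it by at most \<open>e' $ j + e'' $ j - e\<close>, hence by at most \<open>e\<close>; and
  each affine piece exceeds a convex combination of the \<open>gam i\<close>, a fortiori \<open>\<gamma>\<close>, by at most
  \<open>e\<close>.

  Conversely, \<open>r\<close> (when finite) is itself the value of a feasible point
  (\<open>program_feasible_at_error_lower_bound\<close>), so a minimal value cannot exceed it.  Indeed, for
  fixed \<open>j\<close> the definition of \<open>r\<close> says that over \<open>K \<times> K\<close>, under the linear constraint of
  equal observations of \<open>f\<close> and \<open>h\<close>, the minimum over \<open>i\<close> of \<open>gam j f - gam i h\<close> never exceeds
  \<open>2 * r\<close>.  Lagrange duality replaces this minimum by a convex combination \<open>\<sigma>\<close> and the
  constraint by a multiplier \<open>c\<close>.  The resulting inequality is a sum of a function of \<open>f\<close>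
  and a function of \<open>h\<close>, so it splits into the two support function constraints.

  Without a constraint qualification, the separating hyperplane behind the duality could be
  vertical, and \<open>\<sigma>\<close> would be lost.  Here exchanging \<open>f\<close> and \<open>h\<close> makes the set of observation
  differences symmetric about the origin, which puts the origin in its relative interior; this
  serves as Slater's condition
  (\<open>lagrange_multipliers_symmetric\<close>).\<close>

section \<open>Lagrange multipliers under a symmetric linear constraint\<close>

text \<open>The set \<open>E\<close> of pairs \<open>(A x, z)\<close> with \<open>z\<close> strictly above \<open>- g x\<close> is convex and, by
  \<open>primal\<close>, misses the origin.  A hyperplane weakly separating the two has normal \<open>(a, b)\<close>
  with \<open>b\<close> nonnegative, and dividing by the sum of \<open>b\<close> gives the multipliers.  If \<open>b\<close>
  vanished, \<open>a\<close> would be nonnegative on the symmetric set \<open>A ` C\<close> and so orthogonal to it;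
  choosing the normal in the span of \<open>E\<close> excludes this.\<close>

lemma lagrange_multipliers_symmetric:
  fixes A :: "'b::real_vector \<Rightarrow> 'e::euclidean_space"
    and g :: "'i::finite \<Rightarrow> 'b \<Rightarrow> real"
  assumes A: "linear A"
    and nonempty: "C \<noteq> {}"
    and symmetric: "\<And>x. x \<in> C \<Longrightarrow> - A x \<in> A ` C"
    and concave: "\<And>i. concave_on C (g i)"
    and primal: "\<And>x. x \<in> C \<Longrightarrow> A x = 0 \<Longrightarrow> \<exists>i. g i x \<le> 0"
  obtains a :: 'e and s :: "real ^ 'i"
  where "s \<in> std_simplex"
    and "\<And>x. x \<in> C \<Longrightarrow> (\<Sum>i\<in>UNIV. s $ i * g i x) \<le> a \<bullet> A x"
proof -
  define E :: "('e \<times> (real ^ 'i)) set"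
    where "E = {(A x, z) | x z. x \<in> C \<and> (\<forall>i. - g i x < z $ i)}"
  have convex_C: "convex C"
    using concave concave_on_imp_convex by blast
  have "convex E"
  proof (rule convexI)
    fix p q :: "'e \<times> (real ^ 'i)" and u v :: real
    assume "p \<in> E" "q \<in> E" and uv: "0 \<le> u" "0 \<le> v" "u + v = 1"
    then obtain x z y w where
      p: "p = (A x, z)" "x \<in> C" "\<And>i. - g i x < z $ i" and
      q: "q = (A y, w)" "y \<in> C" "\<And>i. - g i y < w $ i"
      unfolding E_def by blast
    have "u *\<^sub>R x + v *\<^sub>R y \<in> C"
      using convex_C p(2) q(2) uv by (rule convexD)
    moreover have "- g i (u *\<^sub>R x + v *\<^sub>R y) < (u *\<^sub>R z + v *\<^sub>R w) $ i" for i
    proof -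
      have "u * g i x + v * g i y \<le> g i (u *\<^sub>R x + v *\<^sub>R y)"
        using concave[of i] p(2) q(2) uv unfolding concave_on_iff by blast
      moreover have "u * (- g i x) + v * (- g i y) < u * z $ i + v * w $ i"
      proof (cases "u = 0")
        case True
        then show ?thesis using uv q(3)[of i] by simp
      next
        case False
        then have "u * (- g i x) < u * z $ i"
          using uv p(3)[of i] by (intro mult_strict_left_mono) auto
        moreover have "v * (- g i y) \<le> v * w $ i"
          using uv q(3)[of i] by (intro mult_left_mono) auto
        ultimately show ?thesis by linarith
      qed
      ultimately show ?thesis by simp
    qed
    moreover have "A (u *\<^sub>R x + v *\<^sub>R y) = u *\<^sub>R A x + v *\<^sub>R A y"
      using A by (simp add: linear_add linear_scale)
    ultimately show "u *\<^sub>R p + v *\<^sub>R q \<in> E"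
      unfolding E_def p(1) q(1)
      by (auto intro!: exI[of _ "u *\<^sub>R x + v *\<^sub>R y"])
  qed
  moreover have "E \<noteq> {}"
  proof -
    obtain x where "x \<in> C" using nonempty by blast
    then have "(A x, \<chi> i. 1 - g i x) \<in> E" unfolding E_def by auto
    then show ?thesis by blast
  qed
  moreover have "0 \<notin> E"
  proof
    assume "0 \<in> E"
    then obtain x where "x \<in> C" "A x = 0" "\<And>i. 0 < g i x"
      unfolding E_def zero_prod_def by auto
    then show False using primal[of x] by (auto simp: not_less[symmetric])
  qed
  ultimately obtain n where n: "n \<in> span E" "n \<noteq> 0" "\<And>p. p \<in> E \<Longrightarrow> 0 \<le> n \<bullet> p"
    using separating_hyperplane_set_0_inspan[of E] by auto
  define a b where "a = fst n" and "b = snd n"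
  have sep: "0 \<le> a \<bullet> A x + (\<Sum>i\<in>UNIV. b $ i * z $ i)"
    if "x \<in> C" "\<And>i. - g i x < z $ i" for x z
  proof -
    have "(A x, z) \<in> E" using that unfolding E_def by blast
    from n(3)[OF this] show ?thesis
      by (simp add: a_def b_def inner_prod_def inner_vec_def)
  qed
  \<comment> \<open>Let \<open>z\<close> decrease to \<open>- g x\<close>, for which \<open>(A x, z)\<close> is only a limit of points of \<open>E\<close>.\<close>
  have limit: "0 \<le> a \<bullet> A x - (\<Sum>i\<in>UNIV. b $ i * g i x)" if x: "x \<in> C" for x
  proof (rule tendsto_lowerbound)
    show "((\<lambda>t. a \<bullet> A x + (\<Sum>i\<in>UNIV. b $ i * (t - g i x)))
        \<longlongrightarrow> a \<bullet> A x - (\<Sum>i\<in>UNIV. b $ i * g i x)) (at_right 0)"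
      by (auto intro!: tendsto_eq_intros simp: sum_negf)
    have "0 \<le> a \<bullet> A x + (\<Sum>i\<in>UNIV. b $ i * (t - g i x))" if "0 < t" for t
      using sep[of x "\<chi> i. t - g i x"] x that by simp
    then show "\<forall>\<^sub>F t in at_right 0. 0 \<le> a \<bullet> A x + (\<Sum>i\<in>UNIV. b $ i * (t - g i x))"
      by (auto simp: eventually_at_right_less intro: eventually_at_rightI[of 0 1])
  qed simp
  have b_nonneg: "0 \<le> b $ j" for j
  proof (rule ccontr)
    assume neg: "\<not> 0 \<le> b $ j"
    obtain x where x: "x \<in> C" using nonempty by blast
    \<comment> \<open>Move \<open>z\<close> along the \<open>j\<close>-th axis, a direction of recession of \<open>E\<close>, far enough to drive the
      functional to \<open>-1\<close> or below.\<close>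
    define B where "B = a \<bullet> A x + (\<Sum>i\<in>UNIV. b $ i * (1 - g i x))"
    define t where "t = (\<bar>B\<bar> + 1) / - b $ j"
    have t: "0 < t" "b $ j * t = - (\<bar>B\<bar> + 1)"
      using neg by (auto simp: t_def divide_simps)
    have "0 \<le> a \<bullet> A x + (\<Sum>i\<in>UNIV. b $ i * ((1 - g i x) + (if i = j then t else 0)))"
      using sep[of x "\<chi> i. (1 - g i x) + (if i = j then t else 0)"] x t by simp
    also have "\<dots> = B + b $ j * t"
      by (simp add: B_def distrib_left sum.distrib if_distrib[of "(*) _"] cong: if_cong)
    finally show False using t by linarith
  qed
  have "b \<noteq> 0"
  proof
    assume b: "b = 0"
    have "a \<bullet> A x = 0" if x: "x \<in> C" for x
    proof -
      obtain y where y: "y \<in> C" "A y = - A x" using symmetric[OF x] by force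
      show ?thesis using limit[OF x] limit[OF y(1)] y(2) b by simp
    qed
    moreover have "fst ` E \<subseteq> A ` C" unfolding E_def by auto
    ultimately have "a \<bullet> v = 0" if "v \<in> fst ` E" for v
      using that by auto
    moreover have "a \<in> span (fst ` E)"
      unfolding a_def using n(1) linear_span_image[OF linear_fst, of E] by blast
    ultimately have "a \<bullet> a = 0"
      using orthogonal_to_span[of a "fst ` E" a] unfolding orthogonal_def by blast
    then show False using b n(2) by (simp add: a_def b_def prod_eq_iff)
  qed
  then obtain j where "b $ j \<noteq> 0" by (auto simp: vec_eq_iff)
  define S where "S = (\<Sum>i\<in>UNIV. b $ i)"
  have "0 < S" unfolding S_def
    using b_nonneg \<open>b $ j \<noteq> 0\<close> by (intro sum_pos2[of _ j]) (auto simp: less_le)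
  show thesis
  proof
    show "(\<chi> i. b $ i / S) \<in> std_simplex"
      using b_nonneg \<open>0 < S\<close>
      by (simp add: std_simplex_def flip: sum_divide_distrib) (simp add: S_def)
    fix x assume "x \<in> C"
    from limit[OF this] have "(\<Sum>i\<in>UNIV. b $ i * g i x) / S \<le> (a \<bullet> A x) / S"
      using \<open>0 < S\<close> by (intro divide_right_mono) auto
    then show "(\<Sum>i\<in>UNIV. (\<chi> i. b $ i / S) $ i * g i x) \<le> ((1 / S) *\<^sub>R a) \<bullet> A x"
      by (simp add: sum_divide_distrib)
  qed
qed

section \<open>Support functions and finite suprema\<close>

lemma support_fun_le_iff:
  "support_fun K \<eta> \<le> ereal s \<longleftrightarrow> (\<forall>f\<in>K. \<eta> f \<le> s)"
  by (simp add: support_fun_def SUP_le_iff)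

text \<open>Since \<open>f\<close> and \<open>g\<close> vary independently, the bound on the sum bounds the sum of the two
  suprema, and both are finite; \<open>s\<close> is the first of them.\<close>

lemma support_fun_split:
  assumes "K \<noteq> {}" and bound: "\<And>f g. f \<in> K \<Longrightarrow> g \<in> K \<Longrightarrow> \<eta> f + \<theta> g \<le> t"
  shows "\<exists>s. support_fun K \<eta> \<le> ereal s \<and> support_fun K \<theta> \<le> ereal (t - s)"
proof -
  obtain g where "g \<in> K" using assms(1) by blast
  define s where "s = (SUP f\<in>K. \<eta> f)"
  have "bdd_above (\<eta> ` K)"
    using bound[OF _ \<open>g \<in> K\<close>] by (intro bdd_aboveI2[of _ _ "t - \<theta> g"]) (simp add: algebra_simps)
  then have "\<forall>f\<in>K. \<eta> f \<le> s"
    unfolding s_def by (auto intro: cSUP_upper)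
  moreover have "\<theta> h \<le> t - s" if h: "h \<in> K" for h
  proof -
    have "s \<le> t - \<theta> h"
      unfolding s_def using bound[OF _ h] assms(1)
      by (intro cSUP_least) (auto simp: algebra_simps)
    then show ?thesis by simp
  qed
  ultimately show ?thesis unfolding support_fun_le_iff by blast
qed

lemma finite_SUP_upper:
  fixes h :: "'i::finite \<Rightarrow> real"
  shows "h i \<le> (SUP i. h i)"
  by (rule cSUP_upper) auto

lemma finite_SUP_attained:
  fixes h :: "'i::finite \<Rightarrow> real"
  obtains i where "(SUP i. h i) = h i"
proof -
  have "Max (range h) \<in> range h" by (rule Max_in) auto
  then obtain i where "Max (range h) = h i" by blast
  with that show thesis by (simp add: cSup_eq_Max)
qed

lemma std_simplex_sum_le_SUP:
  fixes h :: "'i::finite \<Rightarrow> real"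
  assumes "s \<in> std_simplex"
  shows "(\<Sum>i\<in>UNIV. s $ i * h i) \<le> (SUP i. h i)"
proof -
  have "(\<Sum>i\<in>UNIV. s $ i * h i) \<le> (\<Sum>i\<in>UNIV. s $ i * (SUP i. h i))"
    using assms by (intro sum_mono mult_left_mono finite_SUP_upper) (auto simp: std_simplex_def)
  also have "\<dots> = (SUP i. h i)"
    using assms by (simp add: std_simplex_def flip: sum_distrib_right)
  finally show ?thesis .
qed

section \<open>Feasible values bound the worst-case error\<close>

text \<open>The offset \<open>e - e'' $ i\<close> balances the two one-sided errors: it is the largest one for which
  the support function bound \<open>e'' $ i\<close> guarantees an overestimation of at most \<open>e\<close>, and
  \<open>e' $ i + e'' $ i \<le> 2 * e\<close> then makes it large enough for the underestimation.\<close>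

lemma worst_case_error_le_of_feasible:
  assumes feasible: "program_feasible K lam gam (e, e', e'', c, \<sigma>)"
    and gamma_eq: "\<And>f. \<gamma> f = (SUP i. gam i f)"
    and delta_eq: "\<And>y. \<delta> y = (SUP i. e - e'' $ i + (\<Sum>k\<in>UNIV. c $ i $ k * y $ k))"
  shows "worst_case_error K lam \<gamma> \<delta> \<le> ereal e"
proof -
  have simplex: "\<sigma> $ j \<in> std_simplex" and budget: "e' $ j + e'' $ j \<le> 2 * e" for j
    using feasible by (auto simp: program_feasible_def)
  have below: "gam j f - (\<Sum>k\<in>UNIV. c $ j $ k * lam k f) \<le> e' $ j"
    and above: "- (\<Sum>i\<in>UNIV. \<sigma> $ j $ i * gam i f) + (\<Sum>k\<in>UNIV. c $ j $ k * lam k f) \<le> e'' $ j"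
    if "f \<in> K" for j f
    using feasible that unfolding program_feasible_def support_fun_le_iff by auto
  have "\<bar>\<gamma> f - \<delta> (obs_map lam f)\<bar> \<le> e" if f: "f \<in> K" for f
  proof -
    have delta: "\<delta> (obs_map lam f) = (SUP i. e - e'' $ i + (\<Sum>k\<in>UNIV. c $ i $ k * lam k f))"
      by (simp add: delta_eq obs_map_def)
    obtain j where j: "\<gamma> f = gam j f"
      using finite_SUP_attained[of "\<lambda>i. gam i f"] gamma_eq by metis
    have "e - e'' $ j + (\<Sum>k\<in>UNIV. c $ j $ k * lam k f) \<le> \<delta> (obs_map lam f)"
      unfolding delta by (rule finite_SUP_upper)
    with below[OF f, of j] budget[of j] j have 1: "\<gamma> f - \<delta> (obs_map lam f) \<le> e"
      by linarith
    obtain l where l: "\<delta> (obs_map lam f) = e - e'' $ l + (\<Sum>k\<in>UNIV. c $ l $ k * lam k f)"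
      using finite_SUP_attained[of "\<lambda>i. e - e'' $ i + (\<Sum>k\<in>UNIV. c $ i $ k * lam k f)"] delta
      by metis
    have "(\<Sum>i\<in>UNIV. \<sigma> $ l $ i * gam i f) \<le> \<gamma> f"
      unfolding gamma_eq by (rule std_simplex_sum_le_SUP[OF simplex])
    with above[OF f, of l] l have "\<delta> (obs_map lam f) - \<gamma> f \<le> e" by linarith
    with 1 show ?thesis by linarith
  qed
  then show ?thesis by (simp add: worst_case_error_def SUP_le_iff)
qed

section \<open>The lower bound is a feasible value\<close>

text \<open>Duality is applied on \<open>K \<times> K\<close> with \<open>A\<close> the difference of observations and
  \<open>g i (f, h) = gam j f - gam i h - 2 * r\<close>.  On the kernel of \<open>A\<close>, the index \<open>i\<close> attaining
  \<open>\<gamma> h\<close> makes \<open>g i\<close> nonpositive, because \<open>gam j f - \<gamma> h \<le> \<gamma> f - \<gamma> h \<le> 2 * r\<close>.\<close>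

lemma multipliers_of_error_lower_bound:
  fixes K :: "'a::real_vector set"
    and lam :: "'m::finite \<Rightarrow> 'a \<Rightarrow> real" and gam :: "'i::finite \<Rightarrow> 'a \<Rightarrow> real"
  assumes lam_linear: "\<And>k. linear (lam k)"
    and K_convex: "convex K" and K_nonempty: "K \<noteq> {}"
    and gam_linear: "\<And>i. linear (gam i)"
    and gamma_eq: "\<And>f. \<gamma> f = (SUP i. gam i f)"
    and bound: "error_lower_bound K lam \<gamma> \<le> ereal r"
  shows "\<exists>s\<in>std_simplex. \<exists>a :: real ^ 'm. \<forall>f\<in>K. \<forall>h\<in>K.
    (gam j f - (\<Sum>k\<in>UNIV. a $ k * lam k f))
      + (- (\<Sum>i\<in>UNIV. s $ i * gam i h) + (\<Sum>k\<in>UNIV. a $ k * lam k h)) \<le> 2 * r"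
proof -
  define A :: "'a \<times> 'a \<Rightarrow> real ^ 'm" where "A = (\<lambda>(f, h). \<chi> k. lam k f - lam k h)"
  define g where "g = (\<lambda>i (f, h). gam j f - gam i h - 2 * r)"
  have "linear A"
    by (rule linearI)
      (auto simp: A_def vec_eq_iff linear_add[OF lam_linear] linear_scale[OF lam_linear]
        algebra_simps)
  moreover have "K \<times> K \<noteq> {}" using K_nonempty by blast
  moreover have "- A x \<in> A ` (K \<times> K)" if "x \<in> K \<times> K" for x
    using that by (intro image_eqI[of _ _ "prod.swap x"]) (auto simp: A_def vec_eq_iff)
  moreover have "concave_on (K \<times> K) (g i)" for i
    unfolding concave_on_iff
  proof (intro conjI allI ballI impI)
    show "convex (K \<times> K)" using K_convex by (intro convex_Times)
    fix x y :: "'a \<times> 'a" and u v :: real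
    assume "u + v = 1"
    then have "2 * r = u * (2 * r) + v * (2 * r)"
      by (simp flip: distrib_right)
    then show "u * g i x + v * g i y \<le> g i (u *\<^sub>R x + v *\<^sub>R y)"
      by (cases x; cases y)
        (simp add: g_def linear_add[OF gam_linear] linear_scale[OF gam_linear] right_diff_distrib
          distrib_left)
  qed
  moreover have "\<exists>i. g i x \<le> 0" if x: "x \<in> K \<times> K" "A x = 0" for x
  proof -
    obtain f h where fh: "x = (f, h)" "f \<in> K" "h \<in> K" using x(1) by blast
    have "obs_map lam f = obs_map lam h"
      using x(2) by (simp add: fh(1) A_def obs_map_def vec_eq_iff)
    then have "ereal (\<bar>\<gamma> f - \<gamma> h\<bar> / 2) \<le> error_lower_bound K lam \<gamma>"
      unfolding error_lower_bound_def using fh by (intro SUP_upper2[of "(f, h)"]) auto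
    also note bound
    finally have "\<gamma> f - \<gamma> h \<le> 2 * r" by auto
    moreover obtain i where "\<gamma> h = gam i h"
      using finite_SUP_attained[of "\<lambda>i. gam i h"] gamma_eq by metis
    moreover have "gam j f \<le> \<gamma> f"
      unfolding gamma_eq by (rule finite_SUP_upper)
    ultimately show ?thesis by (intro exI[of _ i]) (simp add: g_def fh(1))
  qed
  ultimately obtain a and s :: "real ^ 'i" where s: "s \<in> std_simplex"
    and as: "\<And>x. x \<in> K \<times> K \<Longrightarrow> (\<Sum>i\<in>UNIV. s $ i * g i x) \<le> a \<bullet> A x"
    by (rule lagrange_multipliers_symmetric[of A "K \<times> K" g]) blast+
  have "(gam j f - (\<Sum>k\<in>UNIV. a $ k * lam k f))
      + (- (\<Sum>i\<in>UNIV. s $ i * gam i h) + (\<Sum>k\<in>UNIV. a $ k * lam k h)) \<le> 2 * r"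
    if "f \<in> K" "h \<in> K" for f h
  proof -
    have "(\<Sum>i\<in>UNIV. s $ i * g i (f, h))
        = (\<Sum>i\<in>UNIV. s $ i) * (gam j f - 2 * r) - (\<Sum>i\<in>UNIV. s $ i * gam i h)"
      by (simp add: g_def right_diff_distrib sum_subtractf sum_distrib_right)
    also have "(\<Sum>i\<in>UNIV. s $ i) = 1" using s by (simp add: std_simplex_def)
    finally show ?thesis
      using as[of "(f, h)"] that
      by (simp add: A_def inner_vec_def right_diff_distrib sum_subtractf)
  qed
  then show ?thesis using s by blast
qed

text \<open>The program decouples over \<open>j\<close>: apart from the common value \<open>r\<close>, each row of multipliers
  and each pair of bounds can be chosen on its own.\<close>

lemma program_feasible_at_error_lower_bound:
  fixes K :: "'a::real_vector set"
    and lam :: "'m::finite \<Rightarrow> 'a \<Rightarrow> real" and gam :: "'i::finite \<Rightarrow> 'a \<Rightarrow> real"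
  assumes "\<And>k. linear (lam k)" and "convex K" and K_nonempty: "K \<noteq> {}"
    and "\<And>i. linear (gam i)" and "\<And>f. \<gamma> f = (SUP i. gam i f)"
    and "error_lower_bound K lam \<gamma> \<le> ereal r"
  shows "\<exists>e' e'' c \<sigma>. program_feasible K lam gam (r, e', e'', c, \<sigma>)"
proof -
  define admissible where "admissible j s a t \<longleftrightarrow> s \<in> std_simplex
      \<and> support_fun K (\<lambda>f. gam j f - (\<Sum>k\<in>UNIV. a $ k * lam k f)) \<le> ereal t
      \<and> support_fun K (\<lambda>f. - (\<Sum>i\<in>UNIV. s $ i * gam i f)
          + (\<Sum>k\<in>UNIV. a $ k * lam k f)) \<le> ereal (2 * r - t)"
    for j and s :: "real ^ 'i" and a :: "real ^ 'm" and t
  have "\<exists>s a t. admissible j s a t" for j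
  proof -
    obtain s and a :: "real ^ 'm" where s: "s \<in> std_simplex"
      and sum: "\<forall>f\<in>K. \<forall>h\<in>K. (gam j f - (\<Sum>k\<in>UNIV. a $ k * lam k f))
        + (- (\<Sum>i\<in>UNIV. s $ i * gam i h) + (\<Sum>k\<in>UNIV. a $ k * lam k h)) \<le> 2 * r"
      using multipliers_of_error_lower_bound[OF assms, of j] by (elim bexE exE)
    have "\<exists>t. support_fun K (\<lambda>f. gam j f - (\<Sum>k\<in>UNIV. a $ k * lam k f)) \<le> ereal t
      \<and> support_fun K (\<lambda>f. - (\<Sum>i\<in>UNIV. s $ i * gam i f)
          + (\<Sum>k\<in>UNIV. a $ k * lam k f)) \<le> ereal (2 * r - t)"
      by (rule support_fun_split[OF K_nonempty]) (use sum in simp)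
    then have "\<exists>t. admissible j s a t" using s by (simp add: admissible_def)
    then show ?thesis by blast
  qed
  then obtain s a t where "\<And>j. admissible j (s j) (a j) (t j)"
    by metis
  then have "program_feasible K lam gam
      (r, (\<chi> j. t j), (\<chi> j. 2 * r - t j), (\<chi> j. a j), (\<chi> j. s j))"
    by (simp add: program_feasible_def admissible_def)
  then show ?thesis by (intro exI)
qed

section \<open>Optimality of the estimator\<close>

theorem proposition5:
  fixes K :: "'a::real_vector set"
    and lam :: "'m::finite \<Rightarrow> 'a \<Rightarrow> real"
    and gam :: "'i::finite \<Rightarrow> 'a \<Rightarrow> real"
    and \<gamma> :: "'a \<Rightarrow> real"
    and e :: real
    and e' e'' c0 :: "real ^ 'i"
    and c :: "real ^ 'm ^ 'i"
    and \<sigma> :: "real ^ 'i ^ 'i"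
    and \<delta> :: "real ^ 'm \<Rightarrow> real"
  assumes lam_linear: "\<And>k. linear (lam k)"
    and K_convex: "convex K"
    and K_zero: "0 \<in> K"
    and gam_linear: "\<And>i. linear (gam i)"
    and gamma_eq: "\<And>f. \<gamma> f = (SUP i. gam i f)"
    and minimizer: "is_arg_min fst (program_feasible K lam gam) (e, e', e'', c, \<sigma>)"
    and c0_eq: "\<And>i. c0 $ i = e - e'' $ i"
    and delta_eq: "\<And>y. \<delta> y = (SUP i. c0 $ i + (\<Sum>k\<in>UNIV. c $ i $ k * y $ k))"
  shows "optimal_functional K lam \<gamma> \<delta>"
proof -
  have K_nonempty: "K \<noteq> {}" using K_zero by blast
  have feasible: "program_feasible K lam gam (e, e', e'', c, \<sigma>)"
    and least: "\<And>r x. program_feasible K lam gam (r, x) \<Longrightarrow> e \<le> r"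
    using minimizer by (fastforce simp: is_arg_min_def not_less)+
  have "worst_case_error K lam \<gamma> \<delta> \<le> ereal e"
    using feasible gamma_eq delta_eq unfolding c0_eq
    by (rule worst_case_error_le_of_feasible[of K lam gam e e' e'' c \<sigma> \<gamma> \<delta>])
  also have "ereal e \<le> error_lower_bound K lam \<gamma>"
    \<comment> \<open>Comparing with real upper bounds \<open>r\<close> also covers an infinite lower bound.\<close>
  proof (rule ereal_le_real)
    fix r assume "error_lower_bound K lam \<gamma> \<le> ereal r"
    with lam_linear K_convex K_nonempty gam_linear gamma_eq
    have "\<exists>d' d'' b \<tau>. program_feasible K lam gam (r, d', d'', b, \<tau>)"
      by (rule program_feasible_at_error_lower_bound[of lam K gam \<gamma> r])
    then show "ereal e \<le> ereal r" using least by auto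
  qed
  finally show ?thesis unfolding optimal_functional_def .
qed

end
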